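(* Let $A \in \mathbb{R}^{n\times n}$, $B \in \mathbb{R}^{n\times m}$, let $\Psi_x[\tau+1]$ be a real matrix with $n$ columns, and let $\Xi_x[\tau+1]$ be a real matrix with $n$ rows, say $k$ columns, such that $\mathrm{null}(\Psi_x[\tau+1]) = \{\Xi_x[\tau+1]\theta : \theta \in \mathbb{R}^k\}$. Let $X[\tau] \in \mathbb{R}^{n\times n}$ and $U[\tau] \in \mathbb{R}^{m\times n}$, put $X[\tau+1] = A X[\tau] + B U[\tau]$, and suppose that $X[\tau+1] \in \mathrm{null}(\Psi_x[\tau+1])$. Define $$\Gamma[\tau] = \begin{bmatrix} -B & \Xi_x[\tau+1]\end{bmatrix}, \qquad Q_X = \begin{bmatrix} I & 0\end{bmatrix}\Gamma^+[\tau] A, \qquad Q_\Lambda = \begin{bmatrix} I & 0\end{bmatrix}\left(I - \Gamma^+[\tau]\Gamma[\tau]\right),$$ where in $\begin{bmatrix} I & 0\end{bmatrix}$ the block $I$ is $m\times m$ and the block $0$ is $m \times k$. Then the admissible set of controls at time $\tau$, $$\mathcal{A}_U[\tau] = \{\hat U \in \mathbb{R}^{m\times n} : A X[\tau] + B\hat U \in \mathrm{null}(\Psi_x[\tau+1])\},$$ is given by $$\mathcal{A}_U[\tau] = \{\hat U : \hat U = Q_X X[\tau] + Q_\Lambda \Lambda \text{ for some } \Lambda \in \mathbb{R}^{(m+k)\times n}\}.$$ Moreover, $X[\tau] \in \mathrm{null}(\Psi_x[\tau])$, where $$\Psi_x[\tau] = \left(\Gamma[\tau]\Gamma^+[\tau]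 - I\right)A.$$
   Context: For a matrix $M$, $M^+$ denotes its Moore--Penrose pseudo inverse. $\mathrm{null}(\Psi) = \{v : \Psi v = 0\}$; for a matrix $X$, write $X \in \mathrm{null}(\Psi)$ if every column of $X$ lies in $\mathrm{null}(\Psi)$. Setting: a matrix-valued discrete-time control system $X[\tau+1] = A X[\tau] + B U[\tau]$ with state $X[\tau]$ and control $U[\tau]$, in which the state at time $\tau+1$ is required to satisfy $X[\tau+1]\in\mathrm{null}(\Psi_x[\tau+1])$; a control at time $\tau$ is admissible if it makes this requirement hold at the next step. *)

theory Defs
  imports "Jordan_Normal_Form.Matrix_Kernel"
begin

section \<open>The Moore--Penrose pseudo inverse of a real matrix\<close>

text \<open>The four Penrose conditions.\<close>

definition is_pinv :: "real mat \<Rightarrow> real mat \<Rightarrow> bool" where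
  "is_pinv M N \<longleftrightarrow>
     N \<in> carrier_mat (dim_col M) (dim_row M) \<and>
     M * N * M = M \<and>
     N * M * N = N \<and>
     transpose_mat (M * N) = M * N \<and>
     transpose_mat (N * M) = N * M"

definition pinv :: "real mat \<Rightarrow> real mat" where
  "pinv M = (THE N. is_pinv M N)"

text \<open>Existence and uniqueness, i.e. the description in the definition of \<open>pinv\<close> is proper.\<close>

lemma is_pinv_unique:
  assumes N: "is_pinv M N" and N': "is_pinv M N'"
  shows "N = N'"
proof -
  let ?r = "dim_row M" and ?c = "dim_col M"
  have M: "M \<in> carrier_mat ?r ?c" by simp
  have n: "N \<in> carrier_mat ?c ?r" and n': "N' \<in> carrier_mat ?c ?r"
    using N N' by (auto simp: is_pinv_def)
  have "M * N = M * N' * M * N" using N' by (simp add: is_pinv_def)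
  also have "\<dots> = (M * N') * (M * N)" using M n n' by (intro assoc_mult_mat) auto
  also have "\<dots> = transpose_mat (M * N') * transpose_mat (M * N)"
    using N N' by (simp add: is_pinv_def)
  also have "\<dots> = transpose_mat (M * N * (M * N'))"
    using M n n' by (intro transpose_mult[symmetric, of _ ?r ?r _ ?r]) auto
  also have "M * N * (M * N') = M * N * M * N'"
    using M n n' by (intro assoc_mult_mat[symmetric]) auto
  also have "M * N * M = M" using N by (simp add: is_pinv_def)
  also have "transpose_mat (M * N') = M * N'" using N' by (simp add: is_pinv_def)
  finally have MN: "M * N = M * N'" .
  have "N * M = N * (M * N' * M)" using N' by (simp add: is_pinv_def)
  also have "\<dots> = (N * M) * (N' * M)"
    unfolding assoc_mult_mat[OF M n' M] by (rule assoc_mult_mat[symmetric, OF n M]) (use n' in auto)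
  also have "\<dots> = transpose_mat (N * M) * transpose_mat (N' * M)"
    using N N' by (simp add: is_pinv_def)
  also have "\<dots> = transpose_mat (N' * M * (N * M))"
    using M n n' by (intro transpose_mult[symmetric, of _ ?c ?c _ ?c]) auto
  also have "N' * M * (N * M) = N' * (M * N * M)"
    unfolding assoc_mult_mat[OF M n M] by (rule assoc_mult_mat[OF n' M]) (use n in auto)
  also have "M * N * M = M" using N by (simp add: is_pinv_def)
  also have "transpose_mat (N' * M) = N' * M" using N' by (simp add: is_pinv_def)
  finally have NM: "N * M = N' * M" .
  have "N = N * M * N" using N by (simp add: is_pinv_def)
  also have "\<dots> = N' * (M * N)" unfolding NM using M n n' by (intro assoc_mult_mat) auto
  also have "\<dots> = N' * M * N'" unfolding MN using M n n' by (intro assoc_mult_mat[symmetric]) auto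
  also have "\<dots> = N'" using N' by (simp add: is_pinv_def)
  finally show ?thesis .
qed

lemma ginv_exists:
  fixes M :: "real mat"
  assumes M: "M \<in> carrier_mat nr nc"
  shows "\<exists>G \<in> carrier_mat nc nr. M * G * M = M"
proof -
  let ?s = "Polynomial.smult :: real \<Rightarrow> real poly \<Rightarrow> real poly"
  have vs: "vector_space ?s"
    by unfold_locales
      (simp_all only: Polynomial.smult_add_right Polynomial.smult_add_left
        Polynomial.smult_smult Polynomial.smult_1_left)
  interpret vs: vector_space ?s by (rule vs)
  interpret vp: vector_space_pair ?s ?s by (rule vector_space_pair.intro[OF vs vs])
  define f where "f q = (\<Sum>i<nr. Polynomial.monom (\<Sum>j<nc. M $$ (i,j) * Polynomial.coeff q j) i)"
    for q
  have fc: "Polynomial.coeff (f q) i =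
      (if i < nr then (\<Sum>j<nc. M $$ (i,j) * Polynomial.coeff q j) else 0)" for q i
    unfolding f_def Polynomial.coeff_sum Polynomial.coeff_monom by (subst sum.delta) auto
  have lf: "Vector_Spaces.linear ?s ?s f"
    by (intro Vector_Spaces.linear.intro module_hom.intro vs module_hom_axioms.intro
        vs.module_axioms poly_eqI)
      (auto simp: fc distrib_left sum.distrib sum_distrib_left mult.left_commute)
  from vp.linear_exists_right_inverse_on[OF lf vs.subspace_UNIV]
  obtain g where lg: "Vector_Spaces.linear ?s ?s g" and fgf: "\<And>q. f (g (f q)) = f q"
    by auto
  interpret g: Vector_Spaces.linear ?s ?s g by (rule lg)
  define G where "G = mat nc nr (\<lambda>(j,i). Polynomial.coeff (g (Polynomial.monom 1 i)) j)"
  have G: "G \<in> carrier_mat nc nr" by (simp add: G_def)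
  have fm: "Polynomial.coeff (f (Polynomial.monom 1 l)) i = (if i < nr then M $$ (i,l) else 0)"
    if "l < nc" for i l
  proof -
    have "(\<Sum>j<nc. M $$ (i,j) * Polynomial.coeff (Polynomial.monom (1::real) l) j) =
        (\<Sum>j<nc. if j = l then M $$ (i,j) else 0)"
      by (intro sum.cong) auto
    also have "\<dots> = M $$ (i,l)" using that by simp
    finally show ?thesis by (simp only: fc)
  qed
  have gf: "Polynomial.coeff (g (f (Polynomial.monom 1 l))) j = (\<Sum>i<nr. G $$ (j,i) * M $$ (i,l))"
    if "j < nc" "l < nc" for j l
  proof -
    have "f (Polynomial.monom 1 l) = (\<Sum>i<nr. ?s (M $$ (i,l)) (Polynomial.monom 1 i))"
    proof (rule poly_eqI)
      fix i
      have "(\<Sum>k<nr. M $$ (k,l) * Polynomial.coeff (Polynomial.monom (1::real) k) i) =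
          (\<Sum>k<nr. if k = i then M $$ (k,l) else 0)"
        by (intro sum.cong) auto
      then show "Polynomial.coeff (f (Polynomial.monom 1 l)) i =
          Polynomial.coeff (\<Sum>k<nr. ?s (M $$ (k,l)) (Polynomial.monom 1 k)) i"
        using that by (simp add: fm Polynomial.coeff_sum)
    qed
    then have "g (f (Polynomial.monom 1 l)) = (\<Sum>i<nr. ?s (M $$ (i,l)) (g (Polynomial.monom 1 i)))"
      by (simp only: g.sum g.scale)
    then show ?thesis using that by (simp add: Polynomial.coeff_sum G_def mult.commute)
  qed
  have "M * (G * M) = M"
  proof (rule eq_matI)
    fix i l assume "i < dim_row M" "l < dim_col M"
    then have il: "i < nr" "l < nc" using M by auto
    have GM: "(G * M) $$ (j,l) = (\<Sum>k<nr. G $$ (j,k) * M $$ (k,l))" if "j < nc" for j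
      using that il M G by (auto simp: scalar_prod_def atLeast0LessThan intro!: sum.cong)
    have "(M * (G * M)) $$ (i,l) = (\<Sum>j<nc. M $$ (i,j) * (G * M) $$ (j,l))"
      using il M G by (auto simp: scalar_prod_def atLeast0LessThan intro!: sum.cong)
    also have "\<dots> = (\<Sum>j<nc. M $$ (i,j) * Polynomial.coeff (g (f (Polynomial.monom 1 l))) j)"
      by (rule sum.cong) (use il in \<open>auto simp: GM gf\<close>)
    also have "\<dots> = Polynomial.coeff (f (g (f (Polynomial.monom 1 l)))) i"
      using il by (simp only: fc if_True)
    also have "\<dots> = M $$ (i,l)"
      unfolding fgf using il by (simp add: fm)
    finally show "(M * (G * M)) $$ (i,l) = M $$ (i,l)" .
  qed (use M G in auto)
  moreover have "M * G * M = M * (G * M)" by (rule assoc_mult_mat[OF M G M])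
  ultimately show ?thesis using G by auto
qed

lemma gram_mult_zeroD:
  fixes M :: "real mat"
  assumes M: "M \<in> carrier_mat nr nc" and D: "D \<in> carrier_mat nc k"
    and z: "transpose_mat M * (M * D) = 0\<^sub>m nc k"
  shows "M * D = 0\<^sub>m nr k"
proof -
  define E where "E = M * D"
  have E: "E \<in> carrier_mat nr k" using M D by (auto simp: E_def)
  have T: "transpose_mat M \<in> carrier_mat nc nr" "transpose_mat D \<in> carrier_mat k nc"
    using M D by auto
  have "transpose_mat E * E = transpose_mat D * transpose_mat M * E"
    unfolding E_def transpose_mult[OF M D] ..
  also have "\<dots> = transpose_mat D * (transpose_mat M * E)"
    by (rule assoc_mult_mat[OF T(2,1) E])
  also have "\<dots> = 0\<^sub>m k k" unfolding E_def z by (rule right_mult_zero_mat[OF T(2)])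
  finally have EE: "transpose_mat E * E = 0\<^sub>m k k" .
  have "E = 0\<^sub>m nr k"
  proof (rule eq_matI)
    fix i j assume "i < dim_row (0\<^sub>m nr k :: real mat)" "j < dim_col (0\<^sub>m nr k :: real mat)"
    then have ij: "i < nr" "j < k" by auto
    have "(\<Sum>l<nr. E $$ (l,j) * E $$ (l,j)) = (transpose_mat E * E) $$ (j,j)"
      using ij E by (auto simp: scalar_prod_def atLeast0LessThan intro!: sum.cong)
    also have "\<dots> = 0" using ij by (simp add: EE)
    finally have "E $$ (i,j) * E $$ (i,j) = 0"
      using ij by (subst (asm) sum_nonneg_eq_0_iff) auto
    then show "E $$ (i,j) = 0\<^sub>m nr k $$ (i,j)" using ij by simp
  qed (use E in auto)
  then show ?thesis by (simp add: E_def)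
qed

lemma column_projection_exists:
  fixes M :: "real mat"
  assumes M: "M \<in> carrier_mat nr nc"
  shows "\<exists>L \<in> carrier_mat nc nr. M * L * M = M \<and> transpose_mat (M * L) = M * L"
proof -
  let ?T = "transpose_mat M"
  have T: "?T \<in> carrier_mat nc nr" using M by simp
  have S: "?T * M \<in> carrier_mat nc nc" using M by simp
  obtain G where G: "G \<in> carrier_mat nc nc" and GS: "?T * M * G * (?T * M) = ?T * M"
    using ginv_exists[OF S] by auto
  define L where "L = G * ?T"
  have L: "L \<in> carrier_mat nc nr" using G T by (simp add: L_def)
  have LM: "L * M \<in> carrier_mat nc nc" using L M by simp
  define D where "D = L * M - 1\<^sub>m nc"
  have D: "D \<in> carrier_mat nc nc" unfolding D_def by (rule minus_carrier_mat) simp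
  have I: "1\<^sub>m nc \<in> carrier_mat nc nc" by simp
  have "?T * (M * D) = ?T * M * D" by (rule assoc_mult_mat[symmetric, OF T M D])
  also have "\<dots> = ?T * M * (L * M) - ?T * M * 1\<^sub>m nc"
    unfolding D_def by (rule mult_minus_distrib_mat[OF S LM I])
  also have "L * M = G * (?T * M)" unfolding L_def by (rule assoc_mult_mat[OF G T M])
  also have "?T * M * (G * (?T * M)) = ?T * M"
    using assoc_mult_mat[OF S G S] GS by simp
  also have "?T * M * 1\<^sub>m nc = ?T * M" by (rule right_mult_one_mat[OF S])
  also have "?T * M - ?T * M = 0\<^sub>m nc nc" by (rule minus_r_inv_mat[OF S])
  finally have "M * D = 0\<^sub>m nr nc" by (rule gram_mult_zeroD[OF M D])
  moreover have "M * D = M * L * M - M"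
    unfolding D_def mult_minus_distrib_mat[OF M LM I] right_mult_one_mat[OF M]
      assoc_mult_mat[OF M L M] ..
  ultimately have z: "M * L * M - M = 0\<^sub>m nr nc" by simp
  have hML: "M * L \<in> carrier_mat nr nr" using M L by simp
  have MLM: "M * L * M = M"
  proof (rule eq_matI)
    fix i j assume ij: "i < dim_row M" "j < dim_col M"
    have "(M * L * M - M) $$ (i,j) = 0" unfolding z using ij M by simp
    then show "(M * L * M) $$ (i,j) = M $$ (i,j)"
      unfolding index_minus_mat(1)[OF ij] by simp
  qed (use M L in auto)
  define P where "P = M * L"
  have P: "P \<in> carrier_mat nr nr" using hML by (simp add: P_def)
  have PT: "transpose_mat P \<in> carrier_mat nr nr" using P by simp
  have TP: "?T * transpose_mat P = ?T"
    using transpose_mult[OF P M] MLM by (simp add: P_def)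
  have MG: "M * G \<in> carrier_mat nr nc" using M G by simp
  have PG: "P = M * G * ?T" unfolding P_def L_def by (rule assoc_mult_mat[symmetric, OF M G T])
  have "P * transpose_mat P = M * G * ?T * transpose_mat P" by (simp only: PG[symmetric])
  also have "\<dots> = M * G * ?T" unfolding assoc_mult_mat[OF MG T PT] TP ..
  also have "\<dots> = P" by (rule PG[symmetric])
  finally have PP: "P * transpose_mat P = P" .
  have "transpose_mat (P * transpose_mat P) = P * transpose_mat P"
    unfolding transpose_mult[OF P PT] transpose_transpose ..
  then have "transpose_mat P = P" unfolding PP .
  with MLM L show ?thesis unfolding P_def by blast
qed

lemma is_pinv_exists: "\<exists>N. is_pinv M N"
proof -
  let ?r = "dim_row M" and ?c = "dim_col M" and ?T = "transpose_mat M"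
  have M: "M \<in> carrier_mat ?r ?c" by simp
  have T: "?T \<in> carrier_mat ?c ?r" by simp
  obtain L where L: "L \<in> carrier_mat ?c ?r" and MLM: "M * L * M = M"
    and symP: "transpose_mat (M * L) = M * L"
    using column_projection_exists[OF M] by auto
  obtain K where K: "K \<in> carrier_mat ?r ?c" and TKT: "?T * K * ?T = ?T"
    and symQ: "transpose_mat (?T * K) = ?T * K"
    using column_projection_exists[OF T] by auto
  let ?K = "transpose_mat K"
  define Q where "Q = ?T * K"
  have Kt: "?K \<in> carrier_mat ?c ?r" using K by simp
  have Q: "Q \<in> carrier_mat ?c ?c" unfolding Q_def by (rule mult_carrier_mat[OF T K])
  have QK: "Q = ?K * M"
    using transpose_mult[OF T K] unfolding symQ transpose_transpose Q_def .
  have "M * Q = transpose_mat (Q * ?T)"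
    unfolding transpose_mult[OF Q T] transpose_transpose using symQ by (simp only: Q_def)
  also have "\<dots> = M" unfolding Q_def TKT transpose_transpose ..
  finally have MQ: "M * Q = M" .
  have "Q * Q = ?K * M * Q" by (simp only: QK[symmetric])
  also have "\<dots> = Q" unfolding assoc_mult_mat[OF Kt M Q] MQ by (rule QK[symmetric])
  finally have QQ: "Q * Q = Q" .
  define N where "N = Q * L"
  have N: "N \<in> carrier_mat ?c ?r" unfolding N_def by (rule mult_carrier_mat[OF Q L])
  have MN: "M * N = M * L"
    unfolding N_def assoc_mult_mat[symmetric, OF M Q L] MQ ..
  have LM: "L * M \<in> carrier_mat ?c ?c" by (rule mult_carrier_mat[OF L M])
  have NM: "N * M = Q"
  proof -
    have "N * M = Q * (L * M)" unfolding N_def by (rule assoc_mult_mat[OF Q L M])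
    also have "\<dots> = ?K * M * (L * M)" by (simp only: QK[symmetric])
    also have "\<dots> = ?K * (M * L * M)"
      unfolding assoc_mult_mat[OF Kt M LM] assoc_mult_mat[OF M L M] ..
    finally show ?thesis by (simp only: MLM QK)
  qed
  have "N * M * N = N"
    unfolding NM unfolding N_def assoc_mult_mat[symmetric, OF Q Q L] QQ ..
  moreover have "transpose_mat (N * M) = N * M" unfolding NM Q_def by (rule symQ)
  ultimately have "is_pinv M N"
    unfolding is_pinv_def MN by (intro conjI N MLM symP)
  then show ?thesis ..
qed

lemma is_pinv_pinv: "is_pinv M (pinv M)"
proof -
  obtain N where N: "is_pinv M N" using is_pinv_exists ..
  have "pinv M = N" unfolding pinv_def
    by (rule the_equality) (rule N, erule is_pinv_unique[OF _ N])
  then show ?thesis using N by (simp only:)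
qed

lemma pinv_carrier: "M \<in> carrier_mat nr nc \<Longrightarrow> pinv M \<in> carrier_mat nc nr"
  using conjunct1[OF is_pinv_pinv[unfolded is_pinv_def]] by (metis carrier_matD)


section \<open>Null spaces and admissible controls\<close>

text \<open>\<open>in_null X \<Psi>\<close> says that every column of \<open>X\<close> lies in the null space of \<open>\<Psi>\<close>. The kernel
  \<open>mat_kernel \<Psi>\<close> already forces every column to have dimension \<open>dim_col \<Psi>\<close>.\<close>

definition in_null :: "real mat \<Rightarrow> real mat \<Rightarrow> bool" where
  "in_null X \<Psi> \<longleftrightarrow> (\<forall>j < dim_col X. col X j \<in> mat_kernel \<Psi>)"

text \<open>\<open>append_cols M N\<close> is the block row \<open>[M N]\<close>, dual to \<open>append_rows\<close>.\<close>

definition append_cols :: "real mat \<Rightarrow> real mat \<Rightarrow> real mat" where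
  "append_cols M N = four_block_mat M N (0\<^sub>m 0 (dim_col M)) (0\<^sub>m 0 (dim_col N))"

lemma append_cols_carrier:
  "M \<in> carrier_mat nr nc1 \<Longrightarrow> N \<in> carrier_mat nr nc2 \<Longrightarrow>
     append_cols M N \<in> carrier_mat nr (nc1 + nc2)"
  unfolding append_cols_def carrier_mat_def by simp

definition Gam :: "real mat \<Rightarrow> real mat \<Rightarrow> real mat" where
  "Gam B \<Xi> = append_cols (- B) \<Xi>"

text \<open>In both gains the selector \<open>[I 0]\<close> has \<open>m = dim_col B\<close> rows and \<open>m + k\<close> columns,
  where \<open>k = dim_col \<Xi>\<close>.\<close>

definition selector :: "nat \<Rightarrow> nat \<Rightarrow> real mat" where
  "selector m k = append_cols (1\<^sub>m m) (0\<^sub>m m k)"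

definition Q_X :: "real mat \<Rightarrow> real mat \<Rightarrow> real mat \<Rightarrow> real mat" where
  "Q_X A B \<Xi> = selector (dim_col B) (dim_col \<Xi>) * pinv (Gam B \<Xi>) * A"

definition Q_Lambda :: "real mat \<Rightarrow> real mat \<Rightarrow> real mat" where
  "Q_Lambda B \<Xi> = selector (dim_col B) (dim_col \<Xi>) *
     (1\<^sub>m (dim_col B + dim_col \<Xi>) - pinv (Gam B \<Xi>) * Gam B \<Xi>)"

text \<open>Controls at the current time whose successor state satisfies the constraint \<open>\<Psi>'\<close> imposed at
  the next time.\<close>

definition admissible_controls ::
    "real mat \<Rightarrow> real mat \<Rightarrow> real mat \<Rightarrow> real mat \<Rightarrow> real mat set" where
  "admissible_controls A B \<Psi>' X =
     {U \<in> carrier_mat (dim_col B) (dim_col X). in_null (A * X + B * U) \<Psi>'}"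

definition Psi_prev :: "real mat \<Rightarrow> real mat \<Rightarrow> real mat \<Rightarrow> real mat" where
  "Psi_prev A B \<Xi> = (Gam B \<Xi> * pinv (Gam B \<Xi>) - 1\<^sub>m (dim_row A)) * A"

end

theory Submission
  imports Defs
begin

text \<open>
  Writing a state in \<open>null \<Psi>'\<close> as \<open>\<Xi>' \<Theta>\<close>, a control \<open>U\<close> is admissible iff some \<open>\<Theta>\<close> makes
  the stacked matrix \<open>Z = [U; \<Theta>]\<close> a solution of the linear equation \<open>\<Gamma> Z = A X\<close>. This equation is
  solvable by hypothesis, so its solutions are \<open>\<Gamma>\<^sup>+ A X + (I - \<Gamma>\<^sup>+ \<Gamma>) \<Lambda>\<close>, and \<open>[I 0]\<close> projects them
  to the admissible controls; solvability also gives \<open>\<Gamma> \<Gamma>\<^sup>+ A X = A X\<close>.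
\<close>

section \<open>Solving matrix equations with the pseudo inverse\<close>

lemma mult_pinv_mult: "M * pinv M * M = M"
  using is_pinv_pinv[of M] by (simp add: is_pinv_def)

text \<open>The product \<open>M * pinv M\<close> acts as the identity on the range of
  \<open>M\<close>, so it fixes the right-hand side of any solvable equation. Both claims of the
  theorem rest on this.\<close>

lemma mult_pinv_rhs:
  assumes M: "M \<in> carrier_mat r c" and Z: "Z \<in> carrier_mat c q"
  shows "M * pinv M * (M * Z) = M * Z"
proof -
  have MP: "M * pinv M \<in> carrier_mat r r"
    by (rule mult_carrier_mat[OF M pinv_carrier[OF M]])
  show ?thesis
    unfolding assoc_mult_mat[OF MP M Z, symmetric] mult_pinv_mult ..
qed

lemma add_diff_cancel_mat:
  fixes M N :: "'a::ab_group_add mat"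
  assumes "M \<in> carrier_mat r c" and "N \<in> carrier_mat r c"
  shows "M + (N - M) = N"
  using assms by (intro eq_matI) auto

lemma uminus_add_eq_iff_mat:
  fixes M N C :: "'a::ab_group_add mat"
  assumes M: "M \<in> carrier_mat r c" and N: "N \<in> carrier_mat r c" and C: "C \<in> carrier_mat r c"
  shows "- M + N = C \<longleftrightarrow> C + M = N"
proof
  assume "- M + N = C"
  moreover have "- M + N + M = N" by (rule eq_matI) (use M N in auto)
  ultimately show "C + M = N" by (simp only:)
next
  assume "C + M = N"
  moreover have "- M + (C + M) = C" by (rule eq_matI) (use M C in auto)
  ultimately show "- M + N = C" by (simp only:)
qed

lemma diff_self_mult:
  fixes P :: "'a::comm_ring_1 mat"
  assumes P: "P \<in> carrier_mat c c" and Z: "Z \<in> carrier_mat c q"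
  shows "(1\<^sub>m c - P) * Z = Z - P * Z"
  using minus_mult_distrib_mat[OF one_carrier_mat P Z] left_mult_one_mat[OF Z] by simp

text \<open>A particular solution plus the homogeneous ones: \<open>1\<^sub>m c - pinv M * M\<close>
  projects onto the kernel of \<open>M\<close>, and \<open>Z0\<close> witnesses the solvability that
  makes \<open>pinv M * Y\<close> a particular solution.\<close>

lemma solution_set_pinv:
  assumes M: "M \<in> carrier_mat r c" and Z0: "Z0 \<in> carrier_mat c q" and Y: "M * Z0 = Y"
  shows "{Z \<in> carrier_mat c q. M * Z = Y} =
    {pinv M * Y + (1\<^sub>m c - pinv M * M) * \<Lambda> | \<Lambda>. \<Lambda> \<in> carrier_mat c q}" (is "?S = ?R")
proof
  note N = pinv_carrier[OF M]
  have NM: "pinv M * M \<in> carrier_mat c c" using N M by simp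
  have D: "1\<^sub>m c - pinv M * M \<in> carrier_mat c c" using NM by (rule minus_carrier_mat)
  have Yc: "Y \<in> carrier_mat r q" using M Z0 Y by auto
  have NY: "pinv M * Y \<in> carrier_mat c q" using N Yc by simp
  show "?S \<subseteq> ?R"
  proof
    fix Z assume "Z \<in> ?S"
    then have Z: "Z \<in> carrier_mat c q" and MZ: "M * Z = Y" by auto
    \<comment> \<open>A solution can serve as its own parameter: as \<open>M * Z = Y\<close>, the
      projection removes exactly \<open>pinv M * Y\<close> from \<open>Z\<close>.\<close>
    have "pinv M * Y + (1\<^sub>m c - pinv M * M) * Z = pinv M * Y + (Z - pinv M * Y)"
      unfolding diff_self_mult[OF NM Z] assoc_mult_mat[OF N M Z] MZ ..
    also have "\<dots> = Z" by (rule add_diff_cancel_mat[OF NY Z])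
    finally have "Z = pinv M * Y + (1\<^sub>m c - pinv M * M) * Z" by (rule sym)
    with Z show "Z \<in> ?R" by blast
  qed
  show "?R \<subseteq> ?S"
  proof
    fix Z assume "Z \<in> ?R"
    then obtain L where L: "L \<in> carrier_mat c q"
      and Zeq: "Z = pinv M * Y + (1\<^sub>m c - pinv M * M) * L" by auto
    have DL: "(1\<^sub>m c - pinv M * M) * L \<in> carrier_mat c q" using D L by simp
    have "M * (1\<^sub>m c - pinv M * M) = M - M * (pinv M * M)"
      using mult_minus_distrib_mat[OF M one_carrier_mat NM] right_mult_one_mat[OF M] by simp
    also have "M * (pinv M * M) = M"
      using assoc_mult_mat[OF M N M] mult_pinv_mult by simp
    also have "M - M = 0\<^sub>m r c" by (rule minus_r_inv_mat[OF M])
    finally have "M * ((1\<^sub>m c - pinv M * M) * L) = 0\<^sub>m r q"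
      using assoc_mult_mat[OF M D L] L by simp
    moreover have "M * (pinv M * Y) = Y"
      using mult_pinv_rhs[OF M Z0] assoc_mult_mat[OF M N Yc] unfolding Y by simp
    ultimately have "M * Z = Y"
      unfolding Zeq mult_add_distrib_mat[OF M NY DL] using Yc by simp
    then show "Z \<in> ?S" using Zeq NY DL by auto
  qed
qed

section \<open>Products of block rows and block columns\<close>

lemma append_cols_mult_append_rows:
  assumes M: "M \<in> carrier_mat r c1" and N: "N \<in> carrier_mat r c2"
    and V: "V \<in> carrier_mat c1 q" and W: "W \<in> carrier_mat c2 q"
  shows "append_cols M N * (V @\<^sub>r W) = M * V + N * W"
proof -
  \<comment> \<open>Both factors are two-by-two block matrices padded with empty blocks, so the
    general block product applies; three of the resulting blocks have no rows or no columns.\<close>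
  have "append_cols M N * (V @\<^sub>r W) =
      four_block_mat (M * V + N * W) (M * 0\<^sub>m c1 0 + N * 0\<^sub>m c2 0)
        (0\<^sub>m 0 c1 * V + 0\<^sub>m 0 c2 * W) (0\<^sub>m 0 c1 * 0\<^sub>m c1 0 + 0\<^sub>m 0 c2 * 0\<^sub>m c2 0)"
    unfolding append_cols_def append_rows_def carrier_matD[OF M] carrier_matD[OF N]
      carrier_matD[OF V] carrier_matD[OF W]
    by (rule mult_four_block_mat[OF M N _ _ V _ W]) auto
  also have "\<dots> = M * V + N * W"
    by (rule eq_matI) (use M N V W in auto)
  finally show ?thesis .
qed

lemma append_rows_split:
  fixes Z :: "'a::zero mat"
  assumes Z: "Z \<in> carrier_mat (r1 + r2) q"
  obtains V W where "V \<in> carrier_mat r1 q" "W \<in> carrier_mat r2 q" "Z = V @\<^sub>r W"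
proof
  show "Z = mat r1 q (\<lambda>(i,j). Z $$ (i,j)) @\<^sub>r mat r2 q (\<lambda>(i,j). Z $$ (i + r1,j))"
    by (rule eq_matI) (use Z in \<open>auto simp: append_rows_def\<close>)
qed auto

section \<open>Matrices whose columns lie in a null space\<close>

lemma in_null_iff_param:
  assumes K: "mat_kernel \<Psi> = {\<Xi> *\<^sub>v \<theta> | \<theta>. \<theta> \<in> carrier_vec k}"
    and Xi: "\<Xi> \<in> carrier_mat n k" and Y: "Y \<in> carrier_mat n q"
  shows "in_null Y \<Psi> \<longleftrightarrow> (\<exists>\<Theta> \<in> carrier_mat k q. Y = \<Xi> * \<Theta>)"
proof
  assume "in_null Y \<Psi>"
  then have "\<forall>j<q. \<exists>\<theta>. \<theta> \<in> carrier_vec k \<and> col Y j = \<Xi> *\<^sub>v \<theta>"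
    using Y K by (auto simp: in_null_def)
  then obtain f where f: "\<And>j. j < q \<Longrightarrow> f j \<in> carrier_vec k \<and> col Y j = \<Xi> *\<^sub>v f j"
    by metis
  \<comment> \<open>The parameter vectors chosen separately for the columns of \<open>Y\<close>
    become the columns of one parameter matrix.\<close>
  define T where "T = mat_of_cols k (map f [0..<q])"
  have T: "T \<in> carrier_mat k q" unfolding T_def carrier_mat_def by simp
  have "col T j = f j" if "j < q" for j
    using that f by (simp add: T_def)
  then have "col Y j = col (\<Xi> * T) j" if "j < q" for j
    using that f by (simp only: col_mult2[OF Xi T])
  then have "Y = \<Xi> * T"
    using Y T Xi by (intro mat_col_eqI) (simp_all only: carrier_matD index_mult_mat)
  with T show "\<exists>\<Theta> \<in> carrier_mat k q. Y = \<Xi> * \<Theta>" by blast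
next
  assume "\<exists>\<Theta> \<in> carrier_mat k q. Y = \<Xi> * \<Theta>"
  then obtain T where T: "T \<in> carrier_mat k q" and YT: "Y = \<Xi> * T" by blast
  have "col Y j \<in> mat_kernel \<Psi>" if "j < q" for j
  proof -
    have "col T j \<in> carrier_vec k" using T that by (intro col_carrier_vec) auto
    then show ?thesis unfolding YT col_mult2[OF Xi T that] K by blast
  qed
  then show "in_null Y \<Psi>" using Y by (simp add: in_null_def)
qed

text \<open>This serves the constraint \<open>Psi_prev\<close>, which is given by a formula for the
  matrix and not by a parametrisation of its null space.\<close>

lemma in_null_iff_mult_zero:
  assumes P: "\<Psi> \<in> carrier_mat p n" and X: "X \<in> carrier_mat n q"
  shows "in_null X \<Psi> \<longleftrightarrow> \<Psi> * X = 0\<^sub>m p q"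
proof -
  have "col X j \<in> mat_kernel \<Psi> \<longleftrightarrow> col (\<Psi> * X) j = 0\<^sub>v p" if "j < q" for j
    unfolding mat_kernel[OF P] col_mult2[OF P X that] using X that by simp
  then have "in_null X \<Psi> \<longleftrightarrow> (\<forall>j<q. col (\<Psi> * X) j = 0\<^sub>v p)"
    using X by (simp add: in_null_def)
  also have "\<dots> \<longleftrightarrow> \<Psi> * X = 0\<^sub>m p q"
  proof
    assume "\<forall>j<q. col (\<Psi> * X) j = 0\<^sub>v p"
    then show "\<Psi> * X = 0\<^sub>m p q"
      using P X by (intro mat_col_eqI) (simp_all del: col_mult col_mult2)
  qed simp
  finally show ?thesis .
qed

section \<open>Admissible controls as projected solutions\<close>

lemma Gam_carrier:
  "B \<in> carrier_mat n m \<Longrightarrow> \<Xi> \<in> carrier_mat n k \<Longrightarrow> Gam B \<Xi> \<in> carrier_mat n (m + k)"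
  unfolding Gam_def by (intro append_cols_carrier) auto

lemma selector_carrier: "selector m k \<in> carrier_mat m (m + k)"
  unfolding selector_def by (intro append_cols_carrier) auto

lemma selector_mult_append_rows:
  assumes V: "V \<in> carrier_mat m q" and W: "W \<in> carrier_mat k q"
  shows "selector m k * (V @\<^sub>r W) = V"
  unfolding selector_def
    append_cols_mult_append_rows[OF one_carrier_mat zero_carrier_mat V W] using V W by simp

text \<open>The sign of the block \<open>- B\<close> moves the control term to the other side. With
  \<open>C = A * X\<close>, the right-hand equation says that the control \<open>V\<close> leads to
  the state with parameters \<open>W\<close>.\<close>

lemma Gam_mult_append_rows_eq_iff:
  assumes B: "B \<in> carrier_mat n m" and Xi: "\<Xi> \<in> carrier_mat n k"
    and V: "V \<in> carrier_mat m q" and W: "W \<in> carrier_mat k q" and C: "C \<in> carrier_mat n q"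
  shows "Gam B \<Xi> * (V @\<^sub>r W) = C \<longleftrightarrow> C + B * V = \<Xi> * W"
proof -
  have nB: "- B \<in> carrier_mat n m" using B by simp
  have BV: "B * V \<in> carrier_mat n q" and XW: "\<Xi> * W \<in> carrier_mat n q"
    using B V Xi W by auto
  have "Gam B \<Xi> * (V @\<^sub>r W) = - (B * V) + \<Xi> * W"
    unfolding Gam_def append_cols_mult_append_rows[OF nB Xi V W]
    using B V by simp
  then show ?thesis unfolding uminus_add_eq_iff_mat[OF BV XW C, symmetric] by (simp only:)
qed

text \<open>Admissibility quantifies existentially over the parameters \<open>W\<close> of the
  successor state; dropping the lower block of a stacked solution is that same quantifier.\<close>

lemma admissible_controls_eq_projection:
  assumes A: "A \<in> carrier_mat n n" and B: "B \<in> carrier_mat n m"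
    and Xi: "\<Xi> \<in> carrier_mat n k" and X: "X \<in> carrier_mat n q"
    and K: "mat_kernel \<Psi> = {\<Xi> *\<^sub>v \<theta> | \<theta>. \<theta> \<in> carrier_vec k}"
  shows "admissible_controls A B \<Psi> X =
    (\<lambda>Z. selector m k * Z) ` {Z \<in> carrier_mat (m + k) q. Gam B \<Xi> * Z = A * X}" (is "_ = ?R")
proof -
  have AX: "A * X \<in> carrier_mat n q" using A X by simp
  have mem: "V \<in> admissible_controls A B \<Psi> X \<longleftrightarrow>
      V \<in> carrier_mat m q \<and> (\<exists>W \<in> carrier_mat k q. Gam B \<Xi> * (V @\<^sub>r W) = A * X)" for V
  proof (cases "V \<in> carrier_mat m q")
    case V: True
    have "A * X + B * V \<in> carrier_mat n q" using AX B V by simp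
    from in_null_iff_param[OF K Xi this] show ?thesis
      using V B X Gam_mult_append_rows_eq_iff[OF B Xi V _ AX]
      by (auto simp: admissible_controls_def)
  qed (use B X in \<open>auto simp: admissible_controls_def\<close>)
  show ?thesis
  proof
    show "admissible_controls A B \<Psi> X \<subseteq> ?R"
    proof
      fix V assume "V \<in> admissible_controls A B \<Psi> X"
      then obtain W where V: "V \<in> carrier_mat m q" and W: "W \<in> carrier_mat k q"
        and eq: "Gam B \<Xi> * (V @\<^sub>r W) = A * X" unfolding mem by blast
      have "V @\<^sub>r W \<in> carrier_mat (m + k) q" by (rule carrier_append_rows[OF V W])
      with eq show "V \<in> ?R"
        by (intro image_eqI[of _ _ "V @\<^sub>r W"]) (simp_all add: selector_mult_append_rows[OF V W])
    qed
    show "?R \<subseteq> admissible_controls A B \<Psi> X"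
    proof
      fix V assume "V \<in> ?R"
      then obtain Z where Z: "Z \<in> carrier_mat (m + k) q" and eq: "Gam B \<Xi> * Z = A * X"
        and V: "V = selector m k * Z" by blast
      \<comment> \<open>Every solution is a stack of a control and a parameter matrix, so none
        projects outside the admissible set.\<close>
      obtain V' W where V': "V' \<in> carrier_mat m q" and W: "W \<in> carrier_mat k q"
        and "Z = V' @\<^sub>r W" using append_rows_split[OF Z] .
      then show "V \<in> admissible_controls A B \<Psi> X"
        unfolding mem V using eq by (auto simp: selector_mult_append_rows[OF V' W])
    qed
  qed
qed

theorem theorem1:
  fixes n m k p :: nat
    and A B \<Psi>' \<Xi>' X U X' :: "real mat"
  assumes "A \<in> carrier_mat n n"
    and "B \<in> carrier_mat n m"
    and "\<Psi>' \<in> carrier_mat p n"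
    and "\<Xi>' \<in> carrier_mat n k"
    and "mat_kernel \<Psi>' = {\<Xi>' *\<^sub>v \<theta> | \<theta>. \<theta> \<in> carrier_vec k}"
    and "X \<in> carrier_mat n n"
    and "U \<in> carrier_mat m n"
    and "X' = A * X + B * U"
    and "in_null X' \<Psi>'"
  shows "admissible_controls A B \<Psi>' X =
           {U'. \<exists>\<Lambda> \<in> carrier_mat (m + k) n. U' = Q_X A B \<Xi>' * X + Q_Lambda B \<Xi>' * \<Lambda>}
         \<and> in_null X (Psi_prev A B \<Xi>')"
proof -
  note A = assms(1) and B = assms(2) and Xi = assms(4) and K = assms(5) and X = assms(6)
  let ?G = "Gam B \<Xi>'" and ?S = "selector m k"
  let ?P = "pinv ?G" and ?sols = "{Z \<in> carrier_mat (m + k) n. ?G * Z = A * X}"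
  note adm = admissible_controls_eq_projection[OF A B Xi X K]
  note G = Gam_carrier[OF B Xi] and S = selector_carrier[of m k]
  note P = pinv_carrier[OF G]
  have AX: "A * X \<in> carrier_mat n n" using A X by simp
  have PG: "?P * ?G \<in> carrier_mat (m + k) (m + k)" and GP: "?G * ?P \<in> carrier_mat n n"
    and PAX: "?P * (A * X) \<in> carrier_mat (m + k) n" and SP: "?S * ?P \<in> carrier_mat m n"
    using P G AX S by auto
  have D: "1\<^sub>m (m + k) - ?P * ?G \<in> carrier_mat (m + k) (m + k)" using PG by (rule minus_carrier_mat)
  \<comment> \<open>The given control makes the admissible set nonempty, and a preimage of it under
    the projection is the solution \<open>Z0\<close> needed for solvability.\<close>
  have "U \<in> admissible_controls A B \<Psi>' X"
    using assms by (simp add: admissible_controls_def)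
  then obtain Z0 where Z0: "Z0 \<in> carrier_mat (m + k) n" and eq0: "?G * Z0 = A * X"
    unfolding adm by blast
  \<comment> \<open>Distributing the selector over the general solution produces the two gains, one
    from each summand.\<close>
  have gain: "?S * (?P * (A * X) + (1\<^sub>m (m + k) - ?P * ?G) * L) = Q_X A B \<Xi>' * X + Q_Lambda B \<Xi>' * L"
    if L: "L \<in> carrier_mat (m + k) n" for L
  proof -
    have DL: "(1\<^sub>m (m + k) - ?P * ?G) * L \<in> carrier_mat (m + k) n" using D L by simp
    show ?thesis
      unfolding mult_add_distrib_mat[OF S PAX DL] Q_X_def Q_Lambda_def
        carrier_matD[OF B] carrier_matD[OF Xi]
        assoc_mult_mat[OF SP A X] assoc_mult_mat[OF S P AX] assoc_mult_mat[OF S D L] ..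
  qed
  have "admissible_controls A B \<Psi>' X =
      {U'. \<exists>\<Lambda> \<in> carrier_mat (m + k) n. U' = Q_X A B \<Xi>' * X + Q_Lambda B \<Xi>' * \<Lambda>}"
    (is "_ = ?R")
  proof -
    have "admissible_controls A B \<Psi>' X =
        (\<lambda>\<Lambda>. ?S * (?P * (A * X) + (1\<^sub>m (m + k) - ?P * ?G) * \<Lambda>)) ` carrier_mat (m + k) n"
      unfolding adm solution_set_pinv[OF G Z0 eq0] by blast
    also have "\<dots> = (\<lambda>\<Lambda>. Q_X A B \<Xi>' * X + Q_Lambda B \<Xi>' * \<Lambda>) ` carrier_mat (m + k) n"
      using gain by (rule image_cong[OF refl])
    also have "\<dots> = ?R" by blast
    finally show ?thesis .
  qed
  moreover have "in_null X (Psi_prev A B \<Xi>')"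
  proof -
    have D': "?G * ?P - 1\<^sub>m n \<in> carrier_mat n n" by (rule minus_carrier_mat) simp
    \<comment> \<open>Once \<open>A\<close> is moved next to \<open>X\<close>, the claim says that
      \<open>?G * ?P\<close> fixes \<open>A * X\<close>, which holds because
      \<open>A * X = ?G * Z0\<close> lies in the range of \<open>?G\<close>.\<close>
    have "Psi_prev A B \<Xi>' * X = (?G * ?P - 1\<^sub>m n) * (A * X)"
      unfolding Psi_prev_def carrier_matD[OF A] by (rule assoc_mult_mat[OF D' A X])
    also have "\<dots> = ?G * ?P * (A * X) - A * X"
      unfolding minus_mult_distrib_mat[OF GP one_carrier_mat AX] left_mult_one_mat[OF AX] ..
    also have "\<dots> = 0\<^sub>m n n"
      using mult_pinv_rhs[OF G Z0] minus_r_inv_mat[OF AX] unfolding eq0 by simp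
    finally have z: "Psi_prev A B \<Xi>' * X = 0\<^sub>m n n" .
    have "Psi_prev A B \<Xi>' \<in> carrier_mat n n"
      unfolding Psi_prev_def carrier_matD[OF A] using D' A by (rule mult_carrier_mat)
    from in_null_iff_mult_zero[OF this X] z show ?thesis by simp
  qed
  ultimately show ?thesis ..
qed

end
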